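(* Let $C$ be a commutative ring with unity, let $n\geq 2$, and let $\mathcal{M}_n(C)$ be the $C$-algebra of all $n\times n$ matrices over $C$. Then every derivation $D:\mathcal{M}_n(C)\to\mathcal{M}_n(C)$ is an inner derivation.
   Context: Let $T$ be an algebra over a commutative ring $C$ with unity. A $C$-linear map $D:T\to T$ is a derivation if $D(ab)=D(a)b+aD(b)$ for all $a,b\in T$. A derivation $D:T\to T$ is an inner derivation if there exists $a_0\in T$ such that $D(a)=a_0a-aa_0$ for all $a\in T$. The ring $C$ is not assumed to be $2$-torsion free. *)

theory Defs
  imports "Jordan_Normal_Form.Matrix"
begin

text \<open>
  A \<open>C\<close>-algebra is given here by a carrier set \<open>T\<close>, the operations \<open>+\<close>, \<open>-\<close>, \<open>*\<close> of its
  element type, and a scalar multiplication \<open>scale\<close> by the elements of the ring \<open>C\<close>, which is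
  the whole type \<open>'c\<close>. The carrier is explicit because the square matrices of size \<open>n\<close> form a
  subset \<^term>\<open>carrier_mat n n\<close> of the matrix type; what a map does outside \<open>T\<close> is irrelevant.

  A commutative ring with unity is a type of sort \<open>{comm_ring, comm_monoid_mult}\<close>; unlike
  \<^class>\<open>comm_ring_1\<close>, this does not exclude the zero ring.
\<close>

definition linear_map_on ::
  "('c \<Rightarrow> 'b \<Rightarrow> 'b) \<Rightarrow> 'b set \<Rightarrow> ('b::plus \<Rightarrow> 'b) \<Rightarrow> bool" where
  "linear_map_on scale T D \<longleftrightarrow>
     (\<forall>a\<in>T. D a \<in> T) \<and>
     (\<forall>a\<in>T. \<forall>b\<in>T. D (a + b) = D a + D b) \<and>
     (\<forall>c. \<forall>a\<in>T. D (scale c a) = scale c (D a))"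

definition derivation_on ::
  "('c \<Rightarrow> 'b \<Rightarrow> 'b) \<Rightarrow> 'b set \<Rightarrow> ('b::{plus,times} \<Rightarrow> 'b) \<Rightarrow> bool" where
  "derivation_on scale T D \<longleftrightarrow>
     linear_map_on scale T D \<and>
     (\<forall>a\<in>T. \<forall>b\<in>T. D (a * b) = D a * b + a * D b)"

definition inner_derivation_on ::
  "('c \<Rightarrow> 'b \<Rightarrow> 'b) \<Rightarrow> 'b set \<Rightarrow> ('b::{plus,minus,times} \<Rightarrow> 'b) \<Rightarrow> bool" where
  "inner_derivation_on scale T D \<longleftrightarrow>
     derivation_on scale T D \<and>
     (\<exists>a0\<in>T. \<forall>a\<in>T. D a = a0 * a - a * a0)"

end

theory Submission
  imports Defs
begin

text \<open>
  Let \<open>E k\<close> be the matrix unit at position \<open>(k, 0)\<close> and let the \<open>k\<close>-th column of \<open>a0\<close> be the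
  zeroth column of \<open>D (E k)\<close>. The zeroth column of \<open>D (A * E q) = D A * E q + A * D (E q)\<close> is
  the sum of the \<open>q\<close>-th columns of \<open>D A\<close> and \<open>A * a0\<close>; since \<open>A * E q\<close> is the combination of
  the \<open>E k\<close> with coefficients \<open>A $$ (k, q)\<close>, linearity makes it the \<open>q\<close>-th column of \<open>a0 * A\<close>.
\<close>

definition column_unit :: "nat \<Rightarrow> nat \<Rightarrow> 'a::{zero,one} mat" where
  "column_unit n k = mat n n (\<lambda>(i, j). if i = k \<and> j = 0 then 1 else 0)"

lemma column_unit_carrier [simp]: "column_unit n k \<in> carrier_mat n n"
  by (simp add: column_unit_def)

lemma index_mult_mat_sum:
  assumes "A \<in> carrier_mat n m" and "B \<in> carrier_mat m l" and "i < n" and "j < l"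
  shows "(A * B) $$ (i, j) = (\<Sum>k<m. A $$ (i, k) * B $$ (k, j))"
  using assms by (auto simp: scalar_prod_def lessThan_atLeast0 intro!: sum.cong)

text \<open>Serves twice: with \<open>A\<close> itself it shows that
  \<open>A * column_unit n q\<close> is supported on column 0, and with \<open>D A\<close> in place
  of \<open>A\<close> it recovers the \<open>q\<close>-th column of \<open>D A\<close>.\<close>

lemma index_mult_column_unit:
  fixes A :: "'a::{comm_ring, comm_monoid_mult} mat"
  assumes "A \<in> carrier_mat n n" and "i < n" and "j < n" and "q < n"
  shows "(A * column_unit n q) $$ (i, j) = (if j = 0 then A $$ (i, q) else 0)"
proof -
  have "(A * column_unit n q) $$ (i, j)
      = (\<Sum>k<n. if k = q then (if j = 0 then A $$ (i, q) else 0) else 0)"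
    unfolding index_mult_mat_sum[OF assms(1) column_unit_carrier assms(2,3)]
    using assms by (intro sum.cong) (auto simp: column_unit_def)
  then show ?thesis
    using assms by simp
qed

text \<open>Homogeneity at the scalar 0; this starts the induction below.\<close>

lemma linear_map_on_zero_mat:
  fixes D :: "'a::comm_ring mat \<Rightarrow> 'a mat"
  assumes "linear_map_on (\<cdot>\<^sub>m) (carrier_mat n n) D"
  shows "D (0\<^sub>m n n) = 0\<^sub>m n n"
proof -
  have "D (0\<^sub>m n n) \<in> carrier_mat n n"
    using assms by (simp add: linear_map_on_def)
  moreover have "D (0 \<cdot>\<^sub>m 0\<^sub>m n n) = 0 \<cdot>\<^sub>m D (0\<^sub>m n n)"
    using assms zero_carrier_mat[of n n] unfolding linear_map_on_def by metis
  moreover have "0 \<cdot>\<^sub>m X = 0\<^sub>m n n" if "X \<in> carrier_mat n n" for X :: "'a mat"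
    using that by (intro eq_matI) auto
  ultimately show ?thesis
    by (metis zero_carrier_mat)
qed

text \<open>Linear maps respect linear combinations of column units. The zero of the matrix type
  depends on the size, so the combination is given by its entries, and induction on \<open>m\<close>
  fills in one more row at a time.\<close>

lemma linear_map_on_first_column:
  fixes D :: "'a::{comm_ring, comm_monoid_mult} mat \<Rightarrow> 'a mat"
  assumes "linear_map_on (\<cdot>\<^sub>m) (carrier_mat n n) D" and "p < n" and "q < n" and "m \<le> n"
  shows "D (mat n n (\<lambda>(i, j). if j = 0 \<and> i < m then f i else 0)) $$ (p, q)
    = (\<Sum>k<m. f k * D (column_unit n k) $$ (p, q))"
  using \<open>m \<le> n\<close>
proof (induction m)
  case 0
  have "mat n n (\<lambda>(i, j). if j = 0 \<and> i < 0 then f i else 0) = 0\<^sub>m n n"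
    by (intro eq_matI) auto
  then show ?case
    using linear_map_on_zero_mat[OF assms(1)] assms(2,3) by (simp only:) simp
next
  case (Suc m)
  let ?M = "\<lambda>m. mat n n (\<lambda>(i, j). if j = 0 \<and> i < m then f i else 0)"
  have carrier: "D X \<in> carrier_mat n n" if "X \<in> carrier_mat n n" for X
    using assms(1) that by (simp add: linear_map_on_def)
  have "?M (Suc m) = ?M m + f m \<cdot>\<^sub>m column_unit n m"
    by (intro eq_matI) (auto simp: column_unit_def less_Suc_eq)
  then have "D (?M (Suc m)) = D (?M m) + f m \<cdot>\<^sub>m D (column_unit n m)"
    using assms(1) by (simp add: linear_map_on_def)
  then show ?case
    using Suc assms(2,3) carrier[of "?M m"] carrier[OF column_unit_carrier, of m] by simp
qed

theorem theorem3p2: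
  fixes D :: "'c::{comm_ring, comm_monoid_mult} mat \<Rightarrow> 'c mat" and n :: nat
  assumes "n \<ge> 2"
    and "derivation_on (\<cdot>\<^sub>m) (carrier_mat n n) D"
  shows "inner_derivation_on (\<cdot>\<^sub>m) (carrier_mat n n) D"
proof -
  have linear: "linear_map_on (\<cdot>\<^sub>m) (carrier_mat n n) D"
    and product: "\<And>A B. A \<in> carrier_mat n n \<Longrightarrow> B \<in> carrier_mat n n \<Longrightarrow> D (A * B) = D A * B + A * D B"
    using assms(2) by (auto simp: derivation_on_def)
  have carrier: "D A \<in> carrier_mat n n" if "A \<in> carrier_mat n n" for A
    using linear that by (simp add: linear_map_on_def)
  have "0 < n"
    using assms(1) by simp
  \<comment> \<open>If \<open>D\<close> is the commutator with some b, column 0 of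
    \<open>D (column_unit n k)\<close> is column k of b minus b(0, 0) times the k-th unit vector. So
    this \<open>a0\<close> is b up to a scalar matrix, which is central.\<close>
  define a0 where "a0 = mat n n (\<lambda>(p, k). D (column_unit n k) $$ (p, 0))"
  have a0: "a0 \<in> carrier_mat n n"
    by (simp add: a0_def)
  have "D A = a0 * A - A * a0" if A: "A \<in> carrier_mat n n" for A
  proof (rule eq_matI)
    fix p q
    assume "p < dim_row (a0 * A - A * a0)" and "q < dim_col (a0 * A - A * a0)"
    with A a0 have p: "p < n" and q: "q < n"
      by auto
    let ?E = "column_unit n q :: 'c mat"
    have E: "D ?E \<in> carrier_mat n n"
      by (rule carrier) simp
    \<comment> \<open>The conjunct \<open>i < n\<close> puts the product in the form of
      \<open>linear_map_on_first_column\<close> with \<open>m = n\<close>.\<close>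
    have "A * ?E = mat n n (\<lambda>(i, j). if j = 0 \<and> i < n then A $$ (i, q) else 0)"
    proof (rule eq_matI)
      fix i j
      assume "i < dim_row (mat n n (\<lambda>(i, j). if j = 0 \<and> i < n then A $$ (i, q) else 0))"
        and "j < dim_col (mat n n (\<lambda>(i, j). if j = 0 \<and> i < n then A $$ (i, q) else 0))"
      then show "(A * ?E) $$ (i, j)
          = mat n n (\<lambda>(i, j). if j = 0 \<and> i < n then A $$ (i, q) else 0) $$ (i, j)"
        using index_mult_column_unit[OF A _ _ q, of i j] by simp
    qed (use A in \<open>auto simp: column_unit_def\<close>)
    then have "D (A * ?E) $$ (p, 0) = (\<Sum>k<n. A $$ (k, q) * D (column_unit n k) $$ (p, 0))"
      using linear_map_on_first_column[OF linear p \<open>0 < n\<close> order_refl, of "\<lambda>i. A $$ (i, q)"]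
      by simp
    \<comment> \<open>Commutativity of the ring moves the coefficients \<open>A $$ (k, q)\<close> to
      the right of the entries of \<open>a0\<close>.\<close>
    also have "\<dots> = (a0 * A) $$ (p, q)"
      unfolding index_mult_mat_sum[OF a0 A p q] using p
      by (intro sum.cong) (auto simp: a0_def mult.commute)
    finally have "(D A * ?E + A * D ?E) $$ (p, 0) = (a0 * A) $$ (p, q)"
      using product[OF A column_unit_carrier] by simp
    moreover have "(D A * ?E + A * D ?E) $$ (p, 0) = (D A * ?E) $$ (p, 0) + (A * D ?E) $$ (p, 0)"
      using A E p \<open>0 < n\<close> by (intro index_add_mat) auto
    moreover have "(D A * ?E) $$ (p, 0) = D A $$ (p, q)"
      using index_mult_column_unit[OF carrier[OF A] p \<open>0 < n\<close> q] by simp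
    moreover have "(A * D ?E) $$ (p, 0) = (A * a0) $$ (p, q)"
      unfolding index_mult_mat_sum[OF A E p \<open>0 < n\<close>] index_mult_mat_sum[OF A a0 p q]
      using q by (intro sum.cong) (auto simp: a0_def)
    moreover have "(a0 * A - A * a0) $$ (p, q) = (a0 * A) $$ (p, q) - (A * a0) $$ (p, q)"
      using A a0 p q by (intro index_minus_mat) auto
    \<comment> \<open>At position (p, q) the facts collected give
      \<open>D A + A * a0 = a0 * A\<close>; cancel the second summand.\<close>
    ultimately show "D A $$ (p, q) = (a0 * A - A * a0) $$ (p, q)"
      by (metis add_diff_cancel_right')
  qed (use carrier[OF A] A a0 in auto)
  with assms(2) a0 show ?thesis
    unfolding inner_derivation_on_def by blast
qed

end
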